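(* Let $\sigma,\tau,\eta$ be Heun class coefficients as in the context, and let $p,q$ be the coefficients of the associated deformed equation given in the context. **Case A.** Assume that $s\in\mathbb{C}$ and $\sigma(s)=0$, so that $\sigma(z)=(z-s)\rho(z)$ for a polynomial $\rho$ of degree $\leq2$. Assume that $\sigma,\tau,\eta$ depend on $t$ (in particular $s$ may depend on $t$). Let $m$ be a function of $t$ satisfying (identically in $t,\lambda,z$) $$\partial_t \frac{\tau}{\sigma}(z)=\frac{m\,\tau(s)}{(z-s)^2},$$ $$\frac{\dot\sigma}{\sigma}(z)\big(\eta(z)-\eta(\lambda)\big)-\dot\eta(z)+\dot\eta(\lambda)= m\Big(\frac{\big(\eta(z)-\eta(\lambda)\big)(\lambda-s)\rho(z)}{(z-\lambda)(z-s)}-\eta'(\lambda)\rho(\lambda)\Big)$$ $$\qquad+\frac{m(\lambda-s)}{(z-\lambda)^2}\Big(2\rho\eta(z)-2\rho\eta(\lambda)-\big((\rho\eta)'(z)+(\rho\eta)'(\lambda)\big)(z-\lambda)\Big),$$ $$\frac{\dot\sigma}{\sigma}(z)- \frac{\dot\sigma}{\sigma}(\lambda)=m\,\rho(s)\frac{z-\lambda}{(z-s)(\lambda-s)}.$$ Define $$a=\frac{m(\lambda-s)\rho(z)}{z-\lambda},\qquad b=-\frac{m(\lambda-s)\rho(\lambda)\mu}{z-\lambda},$$ $$H(t,\lambda,\mu)=m\Big(\eta(\lambda)+\big(\tau(\lambda)-(\lambda-s)\rho'(\lambda)\big)\mu+\sigma(\lambda)\mu^2\Big).$$ Then $\lambda(t),\mu(t)$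 satisfy the Hamilton equations $$\frac{d\lambda}{dt}=\frac{\partial H}{\partial\mu}(t,\lambda,\mu),\qquad \frac{d\mu}{dt}=-\frac{\partial H}{\partial\lambda}(t,\lambda,\mu)$$ if and only if the compatibility conditions $$\dot p-ap'+2b'-pa'+a''=0,\qquad \dot q+pb'-2qa'-aq'+b''=0$$ hold. **Case B.** Assume that $\deg\sigma\leq2$ and that $\sigma\eta$ is a polynomial of degree $\leq3$. Suppose that $\tau,\eta$, but not $\sigma$, depend on $t$. Let $m$ be a function of $t$ satisfying (identically in $t,\lambda,z$) $$\frac{\dot \tau(z)}{\sigma(z)}=m\frac{\tau''}{2},\qquad \dot\eta(z)-\dot\eta(\lambda)= m\frac{(\sigma\eta)'''}{6}(z-\lambda).$$ Define $$a=\frac{m\sigma(z)}{z-\lambda},\qquad b=-\frac{m\sigma(\lambda)\mu}{z-\lambda},\qquad H(t,\lambda,\mu)=m\Big(\eta(\lambda)+\big(\tau(\lambda)-\sigma'(\lambda)\big)\mu+\sigma(\lambda)\mu^2\Big).$$ Then $\lambda(t),\mu(t)$ satisfy the Hamilton equations with respect to $H$ if and only if the two compatibility conditions displayed in Case A (with these $a,b$) hold.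
   Context: Heun class coefficients: $\sigma,\tau$ are polynomials in $z$ with $\sigma\neq0$, $\deg\sigma\le3$, $\deg\tau\le2$, and $\eta$ is a rational function of $z$ such that $\sigma\eta$ is a polynomial of degree $\le4$; they may depend (holomorphically) on a complex parameter $t$. For complex $\lambda,\mu$ the associated deformed equation is $v''+pv'+qv=0$ with $$p=\frac{\tau(z)}{\sigma(z)}-\frac{1}{z-\lambda},\qquad q=\frac{1}{\sigma(z)}\Big(\eta(z)-\eta(\lambda)-\mu\big(\tau(\lambda)-\sigma'(\lambda)\big)-\mu^2\sigma(\lambda)+\frac{\mu\sigma(\lambda)}{z-\lambda}\Big).$$ A prime denotes $\partial_z$ and a dot denotes $\partial_t$ at fixed $z$; $f'(\lambda)$, $\dot f(\lambda)$ mean: differentiate first, then set $z=\lambda$. On $\sigma,\tau,\eta$ the dot acts only on the explicit $t$-dependence; in the compatibility conditions $\dot p,\dot q$ are the total $t$-derivatives at fixed $z$ with $\lambda=\lambda(t),\mu=\mu(t)$ substituted, and these conditions are required identically in $z$ and $t$. Expressions such as $\rho\eta(z)$ mean $\rho(z)\eta(z)$. It is understood that $\lambda(t)$ avoids the zeros of $\sigma$ and the poles of $\eta$. *)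

theory Defs
  imports "HOL-Analysis.Analysis" "HOL-Computational_Algebra.Polynomial"
begin

text \<open>
  Throughout, \<open>T\<close> is an open set of parameters \<open>t\<close>. The rational function \<open>\<eta>(z)\<close> is represented
  by a function \<open>\<eta> t\<close>; the polynomial \<open>\<sigma>\<eta>\<close> is carried along explicitly as \<open>\<pi> t\<close>. The values of
  \<open>\<eta> t\<close> at zeros of \<open>\<sigma> t\<close>, which include all poles of \<open>\<eta>\<close>, are left unspecified, and no statement
  below depends on them. Holomorphic dependence on \<open>t\<close> is that of the coefficients of \<open>\<sigma>\<close>, \<open>\<tau>\<close>
  and \<open>\<sigma>\<eta>\<close>.
\<close>

definition heun_class ::
  "complex set \<Rightarrow> (complex \<Rightarrow> complex poly) \<Rightarrow> (complex \<Rightarrow> complex poly) \<Rightarrow>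
    (complex \<Rightarrow> complex \<Rightarrow> complex) \<Rightarrow> (complex \<Rightarrow> complex poly) \<Rightarrow> bool" where
  "heun_class T \<sigma> \<tau> \<eta> \<pi> \<longleftrightarrow>
     (\<forall>t\<in>T. \<sigma> t \<noteq> 0 \<and> degree (\<sigma> t) \<le> 3 \<and> degree (\<tau> t) \<le> 2 \<and> degree (\<pi> t) \<le> 4 \<and>
        (\<forall>z. poly (\<sigma> t) z \<noteq> 0 \<longrightarrow> poly (\<sigma> t) z * \<eta> t z = poly (\<pi> t) z)) \<and>
     (\<forall>i. (\<lambda>t. coeff (\<sigma> t) i) holomorphic_on T \<and>
          (\<lambda>t. coeff (\<tau> t) i) holomorphic_on T \<and>
          (\<lambda>t. coeff (\<pi> t) i) holomorphic_on T)"

definition deformed_p :: "complex poly \<Rightarrow> complex poly \<Rightarrow> complex \<Rightarrow> complex \<Rightarrow> complex" where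
  "deformed_p \<sigma> \<tau> l z = poly \<tau> z / poly \<sigma> z - 1 / (z - l)"

definition deformed_q ::
  "complex poly \<Rightarrow> complex poly \<Rightarrow> (complex \<Rightarrow> complex) \<Rightarrow> complex \<Rightarrow> complex \<Rightarrow> complex \<Rightarrow> complex"
  where
  "deformed_q \<sigma> \<tau> \<eta> l y z =
     1 / poly \<sigma> z *
     (\<eta> z - \<eta> l - y * (poly \<tau> l - poly (pderiv \<sigma>) l) - y\<^sup>2 * poly \<sigma> l + y * poly \<sigma> l / (z - l))"

text \<open>
  The compatibility conditions for \<open>p\<close>, \<open>q\<close>, \<open>a\<close>, \<open>b\<close>, functions of \<open>t\<close> and \<open>z\<close>, required for all
  \<open>t \<in> T\<close> and \<open>z \<in> Z t\<close>. Since \<open>\<lambda>(t)\<close> and \<open>\<mu>(t)\<close> are already substituted in \<open>p\<close> and \<open>q\<close>, the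
  derivatives in \<open>t\<close> are total derivatives at fixed \<open>z\<close>.
\<close>

definition compatibility_conditions ::
  "complex set \<Rightarrow> (complex \<Rightarrow> complex set) \<Rightarrow> (complex \<Rightarrow> complex \<Rightarrow> complex) \<Rightarrow>
    (complex \<Rightarrow> complex \<Rightarrow> complex) \<Rightarrow> (complex \<Rightarrow> complex \<Rightarrow> complex) \<Rightarrow>
    (complex \<Rightarrow> complex \<Rightarrow> complex) \<Rightarrow> bool" where
  "compatibility_conditions T Z p q a b \<longleftrightarrow>
     (\<forall>t\<in>T. \<forall>z\<in>Z t.
        deriv (\<lambda>u. p u z) t - a t z * deriv (p t) z + 2 * deriv (b t) z
          - p t z * deriv (a t) z + deriv (deriv (a t)) z = 0 \<and>
        deriv (\<lambda>u. q u z) t + p t z * deriv (b t) z - 2 * q t z * deriv (a t) z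
          - a t z * deriv (q t) z + deriv (deriv (b t)) z = 0)"

text \<open>
  The compatibility conditions for the deformed equation: the excluded points \<open>z\<close> are the
  singularities of its coefficients.
\<close>

definition deformed_compatibility ::
  "complex set \<Rightarrow> (complex \<Rightarrow> complex poly) \<Rightarrow> (complex \<Rightarrow> complex poly) \<Rightarrow>
    (complex \<Rightarrow> complex \<Rightarrow> complex) \<Rightarrow> (complex \<Rightarrow> complex) \<Rightarrow> (complex \<Rightarrow> complex) \<Rightarrow>
    (complex \<Rightarrow> complex \<Rightarrow> complex) \<Rightarrow> (complex \<Rightarrow> complex \<Rightarrow> complex) \<Rightarrow> bool" where
  "deformed_compatibility T \<sigma> \<tau> \<eta> lam mu a b \<longleftrightarrow>
     compatibility_conditions T (\<lambda>t. {z. poly (\<sigma> t) z \<noteq> 0 \<and> z \<noteq> lam t})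
       (\<lambda>t. deformed_p (\<sigma> t) (\<tau> t) (lam t))
       (\<lambda>t. deformed_q (\<sigma> t) (\<tau> t) (\<eta> t) (lam t) (mu t))
       a b"

definition hamilton_equations ::
  "complex set \<Rightarrow> (complex \<Rightarrow> complex \<Rightarrow> complex \<Rightarrow> complex) \<Rightarrow>
    (complex \<Rightarrow> complex) \<Rightarrow> (complex \<Rightarrow> complex) \<Rightarrow> bool" where
  "hamilton_equations T H lam mu \<longleftrightarrow>
     (\<forall>t\<in>T. deriv lam t = deriv (\<lambda>y. H t (lam t) y) (mu t) \<and>
            deriv mu t = - deriv (\<lambda>l. H t l (mu t)) (lam t))"

end

theory Submission
  imports Defs
begin

text \<open>
  Everything happens at a single \<open>t\<close>. The two compatibility conditions are rational functions of
  \<open>z\<close> into which the derivatives of \<open>\<lambda>\<close> and \<open>\<mu>\<close> enter linearly, and the conditions on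
  \<open>\<sigma>, \<tau>, \<eta>\<close> are designed so that almost all of their poles cancel. The left side of the first
  condition collapses to \<open>(\<partial>H/\<partial>\<mu> - d\<lambda>/dt) / (z - \<lambda>)\<^sup>2\<close>, so it is equivalent to the first
  Hamilton equation (\<open>first_condition\<close>). Once that equation holds, the left side of the second
  condition collapses to \<open>(\<partial>q/\<partial>\<mu>) (d\<mu>/dt + \<partial>H/\<partial>\<lambda>)\<close> (\<open>second_condition\<close>). As \<open>\<sigma>(\<lambda>) \<noteq> 0\<close>,
  the rational function \<open>\<partial>q/\<partial>\<mu>\<close> has a pole at \<open>z = \<lambda>\<close> and is not identically zero, so the second
  condition is then equivalent to the second Hamilton equation.

  The two cases are one computation. In the first case the deformation is attached to the finite
  zero \<open>s\<close> of \<open>\<sigma>\<close>, in the second to the point at infinity. With \<open>\<kappa> = 1/(\<lambda> - s)\<close>, and \<open>\<kappa> = 0\<close> at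
  infinity, \<open>\<sigma>(z) = (1 + \<kappa> (z - \<lambda>)) g(z)\<close> with \<open>g\<close> of degree at most two, and all hypotheses take a
  form that depends polynomially on \<open>\<kappa>\<close> apart from the denominators \<open>1 + \<kappa> (z - \<lambda>)\<close>. The
  locale \<open>pole_deformation\<close> states this form, and \<open>hamilton_iff_compatible\<close> is the common result.
\<close>

section \<open>The two rational identities\<close>

text \<open>
  At \<open>x = - 1 / \<kappa>\<close> the quadratic \<open>g0 + g1 x + g2 x\<^sup>2\<close> equals \<open>N x\<^sup>2\<close> with
  \<open>N = g2 - \<kappa> g1 + \<kappa>\<^sup>2 g0\<close>, so the poles of the two terms at that point cancel. This is why
  \<open>\<sigma>\<close> times the left side of the second compatibility condition has no pole there.
\<close>

lemma moving_pole_cancels: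
  fixes x \<kappa> g0 g1 g2 :: complex
  assumes "x \<noteq> 0" "1 + \<kappa> * x \<noteq> 0"
  shows "\<kappa> * (g0 + g1 * x + g2 * x\<^sup>2) / (x * (1 + \<kappa> * x)) - \<kappa> * (g2 - \<kappa> * g1 + \<kappa>\<^sup>2 * g0) * x / (1 + \<kappa> * x)
         = \<kappa> * g0 / x + \<kappa> * (g1 - \<kappa> * g0)"
  using assms by (simp add: divide_simps) (simp add: algebra_simps power2_eq_square)

text \<open>
  In the next two lemmas \<open>x\<close> is \<open>z - \<lambda>\<close>, the letters \<open>g0, g1, g2\<close> and \<open>t0, t1, t2\<close> are Taylor
  coefficients at \<open>\<lambda>\<close> of quadratics \<open>G\<close> and \<open>\<tau>\<close>, and \<open>\<sigma> = S G\<close> with \<open>S = 1 + \<kappa> x\<close>.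

  The first compatibility condition is \<open>\<partial>\<^sub>t (\<tau>/\<sigma>) - (a \<tau>/\<sigma>)'\<close> plus terms that come from the
  apparent singularity. Since \<open>a \<tau>/\<sigma> = m \<tau> / (x S)\<close> with \<open>\<tau>\<close> quadratic, the second term
  has a double pole at \<open>x = 0\<close> and one where \<open>S\<close> vanishes, replaced by a constant if \<open>\<kappa> = 0\<close>. The
  latter is \<open>\<partial>\<^sub>t (\<tau>/\<sigma>)\<close> by hypothesis, and what survives is a multiple of \<open>1/x\<^sup>2\<close>.
\<close>

lemma first_condition_algebra:
  fixes x \<kappa> m g0 g1 g2 t0 t1 t2 y l' :: complex
  defines "G \<equiv> g0 + g1 * x + g2 * x\<^sup>2" and "G' \<equiv> g1 + 2 * g2 * x"
    and "S \<equiv> 1 + \<kappa> * x"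
    and "T \<equiv> t0 + t1 * x + t2 * x\<^sup>2" and "T' \<equiv> t1 + 2 * t2 * x"
  assumes "x \<noteq> 0" "S \<noteq> 0" "G \<noteq> 0"
  shows "m * (t2 - \<kappa> * t1 + \<kappa>\<^sup>2 * t0) / S\<^sup>2 - l' / x\<^sup>2
     - m * G / x * ((T' * (S * G) - T * (\<kappa> * G + S * G')) / (S * G)\<^sup>2 + 1 / x\<^sup>2)
     + 2 * (m * g0 * y / x\<^sup>2)
     - (T / (S * G) - 1 / x) * (m * (G' / x - G / x\<^sup>2))
     + m * (2 * g2 / x - 2 * G' / x\<^sup>2 + 2 * G / x^3)
     = (m * (t0 - g1 + 2 * g0 * y) - l') / x\<^sup>2"
proof -
  have A: "G / x * ((T' * (S * G) - T * (\<kappa> * G + S * G')) / (S * G)\<^sup>2) + T / (S * G) * (G' / x - G / x\<^sup>2)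
     = T' / (S * x) - T * \<kappa> / (S\<^sup>2 * x) - T / (S * x\<^sup>2)"
    using assms(6-8) by (simp add: divide_simps) algebra
  have B: "T' / (S * x) - T * \<kappa> / (S\<^sup>2 * x) - T / (S * x\<^sup>2) = (t2 - \<kappa> * t1 + \<kappa>\<^sup>2 * t0) / S\<^sup>2 - t0 / x\<^sup>2"
    using assms(6,7) by (simp add: divide_simps) (simp add: S_def T_def T'_def, algebra)
  have C: "- (G / x * (1 / x\<^sup>2)) + 1 / x * (G' / x - G / x\<^sup>2) + (2 * g2 / x - 2 * G' / x\<^sup>2 + 2 * G / x^3) = - g1 / x\<^sup>2"
    using assms(6) by (simp add: divide_simps) (simp add: G_def G'_def, algebra)
  have "m * (t2 - \<kappa> * t1 + \<kappa>\<^sup>2 * t0) / S\<^sup>2 - l' / x\<^sup>2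
     - m * G / x * ((T' * (S * G) - T * (\<kappa> * G + S * G')) / (S * G)\<^sup>2 + 1 / x\<^sup>2)
     + 2 * (m * g0 * y / x\<^sup>2)
     - (T / (S * G) - 1 / x) * (m * (G' / x - G / x\<^sup>2))
     + m * (2 * g2 / x - 2 * G' / x\<^sup>2 + 2 * G / x^3)
     = m * ((t2 - \<kappa> * t1 + \<kappa>\<^sup>2 * t0) / S\<^sup>2) - l' / x\<^sup>2 + 2 * (m * g0 * y / x\<^sup>2)
       - m * (G / x * ((T' * (S * G) - T * (\<kappa> * G + S * G')) / (S * G)\<^sup>2) + T / (S * G) * (G' / x - G / x\<^sup>2))
       + m * (- (G / x * (1 / x\<^sup>2)) + 1 / x * (G' / x - G / x\<^sup>2) + (2 * g2 / x - 2 * G' / x\<^sup>2 + 2 * G / x^3))"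
    unfolding divide_inverse by algebra
  also have "\<dots> = (m * (t0 - g1 + 2 * g0 * y) - l') / x\<^sup>2"
    unfolding A B C by (simp add: algebra_simps diff_divide_distrib add_divide_distrib)
  finally show ?thesis .
qed

text \<open>
  Here \<open>e, e0, e', e1\<close> stand for \<open>\<eta>(z), \<eta>(\<lambda>), \<eta>'(z), \<eta>'(\<lambda>)\<close>, further \<open>de\<close> for the difference of
  the values of \<open>\<partial>\<^sub>t \<eta>\<close> at \<open>z\<close> and \<open>\<lambda>\<close>, \<open>s'\<close> for \<open>(\<partial>\<^sub>t \<sigma>)/\<sigma>\<close> at \<open>z\<close>, \<open>y\<close> for \<open>\<mu>\<close>, and \<open>Q\<close> for
  \<open>\<sigma> q\<close>. The value \<open>l'\<close> of the derivative of \<open>\<lambda>\<close> is the one demanded by the first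
  Hamilton equation. Eliminating \<open>de\<close> and \<open>s'\<close> makes every \<open>\<eta>\<close>-term except \<open>e1\<close> cancel, and the
  remaining identity is one between polynomials in \<open>x\<close> and \<open>1/x\<close>. The first factor of the
  result is \<open>\<partial>q/\<partial>\<mu>\<close>.
\<close>

lemma second_condition_algebra:
  fixes x \<kappa> m g0 g1 g2 t0 t1 t2 y y' e e0 e' e1 de c s' :: complex
  defines "G \<equiv> g0 + g1 * x + g2 * x\<^sup>2" and "G' \<equiv> g1 + 2 * g2 * x"
    and "S \<equiv> 1 + \<kappa> * x"
    and "N \<equiv> g2 - \<kappa> * g1 + \<kappa>\<^sup>2 * g0" and "M \<equiv> t2 - \<kappa> * t1 + \<kappa>\<^sup>2 * t0"
    and "T \<equiv> t0 + t1 * x + t2 * x\<^sup>2"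
    and "V \<equiv> t0 - (g1 + \<kappa> * g0)"
  defines "l' \<equiv> m * (t0 - g1 + 2 * g0 * y)"
  defines "Q \<equiv> e - e0 - y * V - y\<^sup>2 * g0 + y * g0 / x"
  assumes nz: "x \<noteq> 0" "S \<noteq> 0" "G \<noteq> 0"
    and eta: "s' * (e - e0) - de
       = m * ((e - e0) * \<kappa> * G / (x * S) - e1 * \<kappa> * g0)
         + m / x\<^sup>2 * (2 * (G * e) - 2 * (g0 * e0) - ((G' * e + G * e') + (g1 * e0 + g0 * e1)) * x)"
    and sig: "s' = c + m * \<kappa> * N * x / S"
    and V': "V' = (m * M * g0 + c * t0 + t1 * l')
       - (c * (g1 + \<kappa> * g0) + m * \<kappa> * N * g0 + 2 * (g2 + \<kappa> * g1) * l')"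
    and s0': "s0' = c * g0 + (g1 + \<kappa> * g0) * l'"
  shows "(de - e1 * l' - (y' * V + y * V') - (2 * y * y' * g0 + y\<^sup>2 * s0')
            + ((y' * g0 + y * s0') / x + y * g0 * l' / x\<^sup>2)) / (S * G) - s' * Q / (S * G)
      + (T / (S * G) - 1 / x) * (m * g0 * y / x\<^sup>2)
      - 2 * (Q / (S * G)) * (m * (G' / x - G / x\<^sup>2))
      - m * G / x * ((e' - y * g0 / x\<^sup>2) / (S * G) - (\<kappa> * G + S * G') * Q / (S * G)\<^sup>2)
      - 2 * (m * g0 * y) / x ^ 3
     = (g0 / x - V - 2 * y * g0) / (S * G)
         * (y' + m * (e1 + (t1 - \<kappa> * g1 - 2 * g2) * y + (g1 + \<kappa> * g0) * y\<^sup>2))"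
    (is "?L = ?R")
proof -
  define R where "R = \<kappa> * g0 / x + \<kappa> * (g1 - \<kappa> * g0)"
  have cancel: "\<kappa> * G / (x * S) - \<kappa> * N * x / S = R"
    unfolding R_def G_def S_def N_def using moving_pole_cancels nz unfolding S_def by blast
  have de: "de = (c - m * R) * (e - e0) + m * e1 * \<kappa> * g0
     - m / x\<^sup>2 * (2 * (G * e) - 2 * (g0 * e0) - ((G' * e + G * e') + (g1 * e0 + g0 * e1)) * x)"
  proof -
    have "de = s' * (e - e0) - (s' * (e - e0) - de)" by simp
    also have "\<dots> = (c + m * (\<kappa> * N * x / S)) * (e - e0) - (m * ((e - e0) * (\<kappa> * G / (x * S)) - e1 * \<kappa> * g0)
         + m / x\<^sup>2 * (2 * (G * e) - 2 * (g0 * e0) - ((G' * e + G * e') + (g1 * e0 + g0 * e1)) * x))"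
      unfolding eta unfolding sig by (simp add: mult.assoc)
    finally show ?thesis unfolding cancel[symmetric] by (simp add: algebra_simps)
  qed
  have SG: "S * G \<noteq> 0" using nz by simp
  \<comment> \<open>Collecting the coefficient of \<open>Q\<close> isolates the only remaining occurrence of \<open>S\<close> in a denominator.\<close>
  have "?L * (S * G) = (de - e1 * l' - (y' * V + y * V') - (2 * y * y' * g0 + y\<^sup>2 * s0')
            + ((y' * g0 + y * s0') / x + y * g0 * l' / x\<^sup>2))
      + (T - S * G / x) * (m * g0 * y / x\<^sup>2)
      - m * G / x * (e' - y * g0 / x\<^sup>2) - S * G * (2 * (m * g0 * y) / x ^ 3)
      + Q * (- s' - 2 * m * (G' / x - G / x\<^sup>2) + m / x * ((\<kappa> * G + S * G') / S))"
    using nz by (simp add: divide_simps) algebra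
  also have "- s' - 2 * m * (G' / x - G / x\<^sup>2) + m / x * ((\<kappa> * G + S * G') / S)
     = - c + m * (R - G' / x + 2 * G / x\<^sup>2)"
    unfolding sig cancel[symmetric] using nz by (simp add: divide_simps) algebra
  also have "(de - e1 * l' - (y' * V + y * V') - (2 * y * y' * g0 + y\<^sup>2 * s0')
            + ((y' * g0 + y * s0') / x + y * g0 * l' / x\<^sup>2))
      + (T - S * G / x) * (m * g0 * y / x\<^sup>2)
      - m * G / x * (e' - y * g0 / x\<^sup>2) - S * G * (2 * (m * g0 * y) / x ^ 3)
      + Q * (- c + m * (R - G' / x + 2 * G / x\<^sup>2))
    = (g0 / x - V - 2 * y * g0)
         * (y' + m * (e1 + (t1 - \<kappa> * g1 - 2 * g2) * y + (g1 + \<kappa> * g0) * y\<^sup>2))"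
    unfolding de Q_def V' s0' l'_def R_def G_def G'_def T_def S_def V_def N_def M_def
    using nz(1) by (simp add: divide_simps) algebra
  finally have "?L * (S * G) = \<dots>" .
  then show ?thesis using SG
    by (simp add: nonzero_eq_divide_eq)
qed

section \<open>Polynomials depending on a parameter\<close>

text \<open>
  Differentiating the coefficients makes \<open>\<partial>\<^sub>t P\<close> a polynomial again, so that it can be evaluated
  at \<open>\<lambda>\<close> and differentiated in \<open>z\<close>. The degree bound \<open>n\<close> only serves to keep the sum finite.
\<close>

definition param_deriv :: "nat \<Rightarrow> (complex \<Rightarrow> complex poly) \<Rightarrow> complex \<Rightarrow> complex poly" where
  "param_deriv n P t = (\<Sum>i\<le>n. monom (deriv (\<lambda>u. coeff (P u) i) t) i)"

lemma poly_eq_sum_le: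
  fixes p :: "'a::comm_semiring_1 poly"
  assumes "degree p \<le> n"
  shows "poly p x = (\<Sum>i\<le>n. coeff p i * x ^ i)"
  unfolding poly_altdef using assms
  by (intro sum.mono_neutral_left) (auto simp: coeff_eq_0)

lemma poly_pderiv_eq_sum_le:
  fixes p :: "complex poly"
  assumes "degree p \<le> n"
  shows "poly (pderiv p) x = (\<Sum>i\<le>n. coeff p i * (of_nat i * x ^ (i - 1)))"
proof -
  have "((\<lambda>x. \<Sum>i\<le>n. coeff p i * x ^ i) has_field_derivative
      (\<Sum>i\<le>n. coeff p i * (of_nat i * x ^ (i - 1)))) (at x)"
    by (auto intro!: derivative_eq_intros sum.cong)
  then have "(poly p has_field_derivative (\<Sum>i\<le>n. coeff p i * (of_nat i * x ^ (i - 1)))) (at x)"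
    by (subst ext[OF poly_eq_sum_le[OF assms]])
  then show ?thesis
    using DERIV_unique poly_DERIV by blast
qed

text \<open>The chain rule for the total derivative along a moving point \<open>f t\<close>.\<close>

lemma poly_family_has_derivative:
  assumes "open T" "t \<in> T" and deg: "\<And>u. u \<in> T \<Longrightarrow> degree (P u) \<le> n"
    and hol: "\<And>i. (\<lambda>u. coeff (P u) i) holomorphic_on T"
    and f: "(f has_field_derivative f') (at t)"
  shows "((\<lambda>u. poly (P u) (f u)) has_field_derivative
           poly (param_deriv n P t) (f t) + poly (pderiv (P t)) (f t) * f') (at t)"
proof -
  have c: "((\<lambda>u. coeff (P u) i) has_field_derivative deriv (\<lambda>u. coeff (P u) i) t) (at t)" for i
    using holomorphic_derivI[OF hol assms(1,2)] .
  have "((\<lambda>u. \<Sum>i\<le>n. coeff (P u) i * f u ^ i) has_field_derivative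
      (\<Sum>i\<le>n. deriv (\<lambda>u. coeff (P u) i) t * f t ^ i
         + coeff (P t) i * (of_nat i * f t ^ (i - 1)) * f')) (at t)"
    by (auto intro!: derivative_eq_intros c f sum.cong)
  also have "(\<Sum>i\<le>n. deriv (\<lambda>u. coeff (P u) i) t * f t ^ i
         + coeff (P t) i * (of_nat i * f t ^ (i - 1)) * f')
      = poly (param_deriv n P t) (f t) + poly (pderiv (P t)) (f t) * f'"
    unfolding poly_pderiv_eq_sum_le[OF deg[OF assms(2)]] param_deriv_def
    by (simp add: sum.distrib sum_distrib_right poly_sum poly_monom)
  finally show ?thesis
    by (rule has_field_derivative_transform_within_open[OF _ assms(1,2)])
      (simp add: poly_eq_sum_le[OF deg])
qed

text \<open>The total derivative of \<open>\<sigma>'(\<lambda>)\<close> involves \<open>\<partial>\<^sub>t \<partial>\<^sub>z \<sigma>\<close>, which this lemma reduces to \<open>\<partial>\<^sub>t \<sigma>\<close>.\<close>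

lemma param_deriv_pderiv:
  assumes "open T" "t \<in> T" and deg: "\<And>u. u \<in> T \<Longrightarrow> degree (P u) \<le> n"
    and hol: "\<And>i. (\<lambda>u. coeff (P u) i) holomorphic_on T"
  shows "param_deriv n (\<lambda>u. pderiv (P u)) t = pderiv (param_deriv n P t)"
proof -
  have coeff_param_deriv: "coeff (param_deriv n Q t) j = deriv (\<lambda>u. coeff (Q u) j) t"
    if "\<And>u. u \<in> T \<Longrightarrow> degree (Q u) \<le> n" for Q j
  proof (cases "j \<le> n")
    case True
    then show ?thesis by (simp add: param_deriv_def coeff_sum if_distrib cong: if_cong)
  next
    case False
    have "deriv (\<lambda>u. coeff (Q u) j) t = deriv (\<lambda>u. 0) t"
      using False that assms(1,2)
      by (intro deriv_cong_ev eventually_nhds_in_open[THEN eventually_mono, OF assms(1,2)] refl)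
        (force intro: coeff_eq_0)
    then show ?thesis using False by (simp add: param_deriv_def coeff_sum)
  qed
  have "deriv (\<lambda>u. of_nat (Suc j) * coeff (P u) (Suc j)) t
      = of_nat (Suc j) * deriv (\<lambda>u. coeff (P u) (Suc j)) t" for j
    by (intro DERIV_imp_deriv DERIV_cmult holomorphic_derivI[OF hol assms(1,2)])
  then show ?thesis
    by (intro poly_eqI) (subst coeff_param_deriv,
        auto simp: coeff_pderiv coeff_param_deriv[OF deg] degree_pderiv
          intro: order.trans[OF diff_le_self] deg simp del: of_nat_Suc)
qed

lemma taylor_quadratic:
  fixes p :: "complex poly"
  assumes "degree p \<le> 2"
  shows "poly p z = poly p l + poly (pderiv p) l * (z - l)
           + poly (pderiv (pderiv p)) l / 2 * (z - l)\<^sup>2"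
    and "poly (pderiv p) z = poly (pderiv p) l + 2 * (poly (pderiv (pderiv p)) l / 2) * (z - l)"
    and "poly (pderiv (pderiv p)) z = poly (pderiv (pderiv p)) l"
proof -
  obtain a b c where p: "p = [:a, b, c:]"
  proof -
    have "p = [:coeff p 0, coeff p 1, coeff p 2:]"
      using assms by (intro poly_eqI) (auto simp: coeff_pCons coeff_eq_0 numeral_2_eq_2 split: nat.splits)
    then show ?thesis by (rule that)
  qed
  show "poly p z = poly p l + poly (pderiv p) l * (z - l)
           + poly (pderiv (pderiv p)) l / 2 * (z - l)\<^sup>2"
    and "poly (pderiv p) z = poly (pderiv p) l + 2 * (poly (pderiv (pderiv p)) l / 2) * (z - l)"
    and "poly (pderiv (pderiv p)) z = poly (pderiv (pderiv p)) l"
    unfolding p by (simp_all add: pderiv_pCons algebra_simps power2_eq_square)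
qed

text \<open>
  The error term of the trapezoidal rule, exact for cubics. Applied to \<open>\<sigma>\<eta>\<close> it turns the general
  condition on \<open>\<eta>\<close> into the one for a singular point at infinity.
\<close>

lemma cubic_trapezoid:
  fixes p :: "complex poly"
  assumes "degree p \<le> 3"
  shows "2 * poly p z - 2 * poly p l - (poly (pderiv p) z + poly (pderiv p) l) * (z - l)
    = - (poly (pderiv (pderiv (pderiv p))) z / 6) * (z - l) ^ 3"
proof -
  have p: "p = [:coeff p 0, coeff p 1, coeff p 2, coeff p 3:]"
    using assms
    by (intro poly_eqI)
      (auto simp: coeff_pCons coeff_eq_0 numeral_2_eq_2 numeral_3_eq_3 split: nat.splits)
  show ?thesis
    by (subst (1 2 3 4 5) p) (simp add: pderiv_pCons algebra_simps power2_eq_square power3_eq_cube)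
qed

section \<open>Derivatives of the deformed coefficients\<close>

locale deformed_heun =
  fixes T :: "complex set"
    and \<sigma> \<tau> \<pi> :: "complex \<Rightarrow> complex poly"
    and \<eta> :: "complex \<Rightarrow> complex \<Rightarrow> complex"
    and lam mu :: "complex \<Rightarrow> complex"
    and t :: complex
  assumes open_T: "open T"
    and heun: "heun_class T \<sigma> \<tau> \<eta> \<pi>"
    and lam_holo: "lam holomorphic_on T"
    and mu_holo: "mu holomorphic_on T"
    and sigma_lam: "poly (\<sigma> t) (lam t) \<noteq> 0"
    and t_in: "t \<in> T"
begin

lemma lam_deriv: "(lam has_field_derivative deriv lam t) (at t)"
  using holomorphic_derivI[OF lam_holo open_T t_in] .

lemma mu_deriv: "(mu has_field_derivative deriv mu t) (at t)"
  using holomorphic_derivI[OF mu_holo open_T t_in] .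

lemma coeffs_holo:
  "(\<lambda>u. coeff (\<sigma> u) i) holomorphic_on T" "(\<lambda>u. coeff (\<tau> u) i) holomorphic_on T"
  "(\<lambda>u. coeff (\<pi> u) i) holomorphic_on T"
  using heun unfolding heun_class_def by auto

lemma degrees:
  assumes "u \<in> T"
  shows "degree (\<sigma> u) \<le> 3" "degree (\<tau> u) \<le> 2" "degree (\<pi> u) \<le> 4"
  using heun assms unfolding heun_class_def by auto

abbreviation "\<sigma>d \<equiv> param_deriv 3 \<sigma> t"
abbreviation "\<tau>d \<equiv> param_deriv 2 \<tau> t"

lemma families:
  assumes "(f has_field_derivative f') (at t)"
  shows "((\<lambda>u. poly (\<sigma> u) (f u)) has_field_derivative
           poly \<sigma>d (f t) + poly (pderiv (\<sigma> t)) (f t) * f') (at t)"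
    and "((\<lambda>u. poly (\<tau> u) (f u)) has_field_derivative
           poly \<tau>d (f t) + poly (pderiv (\<tau> t)) (f t) * f') (at t)"
    and "((\<lambda>u. poly (\<pi> u) (f u)) has_field_derivative
           poly (param_deriv 4 \<pi> t) (f t) + poly (pderiv (\<pi> t)) (f t) * f') (at t)"
  by (rule poly_family_has_derivative[OF open_T t_in degrees(1) coeffs_holo(1) assms]
      poly_family_has_derivative[OF open_T t_in degrees(2) coeffs_holo(2) assms]
      poly_family_has_derivative[OF open_T t_in degrees(3) coeffs_holo(3) assms]; assumption)+

lemma sigma_pderiv_family:
  assumes "(f has_field_derivative f') (at t)"
  shows "((\<lambda>u. poly (pderiv (\<sigma> u)) (f u)) has_field_derivative
           poly (pderiv \<sigma>d) (f t) + poly (pderiv (pderiv (\<sigma> t))) (f t) * f') (at t)"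
proof -
  have "degree (pderiv (\<sigma> u)) \<le> 3" if "u \<in> T" for u
    using degrees(1)[OF that] by (simp add: degree_pderiv)
  moreover have "(\<lambda>u. coeff (pderiv (\<sigma> u)) i) holomorphic_on T" for i
    unfolding coeff_pderiv by (intro holomorphic_intros coeffs_holo)
  ultimately show ?thesis
    using poly_family_has_derivative[OF open_T t_in _ _ assms, of "\<lambda>u. pderiv (\<sigma> u)" 3]
      param_deriv_pderiv[OF open_T t_in degrees(1) coeffs_holo(1)] by simp
qed

lemma sigma_param_deriv: "deriv (\<lambda>u. poly (\<sigma> u) z) t = poly \<sigma>d z"
  using families(1)[OF DERIV_const[of z]] by (intro DERIV_imp_deriv) simp

lemma tau_over_sigma_param_deriv:
  assumes "poly (\<sigma> t) z \<noteq> 0"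
  shows "((\<lambda>u. poly (\<tau> u) z / poly (\<sigma> u) z) has_field_derivative
     (poly \<tau>d z * poly (\<sigma> t) z - poly (\<tau> t) z * poly \<sigma>d z) / (poly (\<sigma> t) z)\<^sup>2) (at t)"
  using families(1)[OF DERIV_const[of z]] families(2)[OF DERIV_const[of z]] assms
  by (auto intro!: derivative_eq_intros simp: power2_eq_square)

lemma eta_eq:
  assumes "u \<in> T" "poly (\<sigma> u) z \<noteq> 0"
  shows "\<eta> u z = poly (\<pi> u) z / poly (\<sigma> u) z"
  using heun assms unfolding heun_class_def by (auto simp: field_simps)

lemma eta_deriv:
  assumes "poly (\<sigma> t) z \<noteq> 0"
  shows "(\<eta> t has_field_derivative
    (poly (pderiv (\<pi> t)) z * poly (\<sigma> t) z - poly (\<pi> t) z * poly (pderiv (\<sigma> t)) z)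
      / (poly (\<sigma> t) z)\<^sup>2) (at z)"
proof -
  have "open {z. poly (\<sigma> t) z \<noteq> 0}"
    by (intro open_Collect_neq continuous_intros)
  moreover have "((\<lambda>z. poly (\<pi> t) z / poly (\<sigma> t) z) has_field_derivative
    (poly (pderiv (\<pi> t)) z * poly (\<sigma> t) z - poly (\<pi> t) z * poly (pderiv (\<sigma> t)) z)
      / (poly (\<sigma> t) z)\<^sup>2) (at z)"
    using assms by (auto intro!: derivative_eq_intros simp: power2_eq_square)
  ultimately show ?thesis
    using assms eta_eq[OF t_in]
    by (elim has_field_derivative_transform_within_open) auto
qed

lemma eta_has_deriv:
  assumes "poly (\<sigma> t) z \<noteq> 0"
  shows "(\<eta> t has_field_derivative deriv (\<eta> t) z) (at z)"
  using eta_deriv[OF assms] DERIV_imp_deriv by metis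

text \<open>
  Only \<open>\<sigma>\<eta>\<close> is known to depend holomorphically on \<open>t\<close>, so the chain rule for \<open>\<eta>\<close> is obtained from
  the quotient \<open>\<pi>/\<sigma>\<close>, with which \<open>\<eta>\<close> agrees as long as \<open>\<sigma>\<close> does not vanish.
\<close>

lemma eta_total_deriv:
  assumes f: "(f has_field_derivative f') (at t)" and nz: "poly (\<sigma> t) (f t) \<noteq> 0"
  shows "((\<lambda>u. \<eta> u (f u)) has_field_derivative
           deriv (\<lambda>u. \<eta> u (f t)) t + deriv (\<eta> t) (f t) * f') (at t)"
proof -
  let ?D = "\<lambda>d z. ((poly (param_deriv 4 \<pi> t) z + poly (pderiv (\<pi> t)) z * d) * poly (\<sigma> t) z
      - poly (\<pi> t) z * (poly \<sigma>d z + poly (pderiv (\<sigma> t)) z * d)) / (poly (\<sigma> t) z)\<^sup>2"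
  have *: "((\<lambda>u. \<eta> u (h u)) has_field_derivative ?D d (h t)) (at t)"
    if h: "(h has_field_derivative d) (at t)" and nz: "poly (\<sigma> t) (h t) \<noteq> 0" for h d
  proof -
    have "((\<lambda>u. poly (\<pi> u) (h u) / poly (\<sigma> u) (h u)) has_field_derivative ?D d (h t)) (at t)"
      using families(1)[OF h] families(3)[OF h] nz
      by (auto intro!: derivative_eq_intros simp: power2_eq_square)
    moreover have "\<forall>\<^sub>F u in nhds t. poly (\<pi> u) (h u) / poly (\<sigma> u) (h u) = \<eta> u (h u)"
    proof -
      have "isCont (\<lambda>u. poly (\<sigma> u) (h u)) t"
        using families(1)[OF h] DERIV_isCont by blast
      then have "\<forall>\<^sub>F u in nhds t. poly (\<sigma> u) (h u) \<noteq> 0"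
        using nz by (simp add: isCont_def tendsto_imp_eventually_ne eventually_nhds_conv_at)
      with eventually_nhds_in_open[OF open_T t_in] show ?thesis
        by eventually_elim (simp add: eta_eq)
    qed
    ultimately show ?thesis
      by (simp add: DERIV_cong_ev)
  qed
  have "deriv (\<lambda>u. \<eta> u (f t)) t = ?D 0 (f t)"
    using *[of "\<lambda>_. f t" 0] nz by (intro DERIV_imp_deriv) auto
  moreover have "deriv (\<eta> t) (f t) = (poly (pderiv (\<pi> t)) (f t) * poly (\<sigma> t) (f t)
      - poly (\<pi> t) (f t) * poly (pderiv (\<sigma> t)) (f t)) / (poly (\<sigma> t) (f t))\<^sup>2"
    using eta_deriv[OF nz] by (rule DERIV_imp_deriv)
  moreover have "?D f' (f t) = ?D 0 (f t) + (poly (pderiv (\<pi> t)) (f t) * poly (\<sigma> t) (f t)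
      - poly (\<pi> t) (f t) * poly (pderiv (\<sigma> t)) (f t)) / (poly (\<sigma> t) (f t))\<^sup>2 * f'"
    using nz by (simp add: divide_simps) algebra
  ultimately show ?thesis
    using *[OF f nz] by simp
qed

lemma deformed_p_deriv_z:
  assumes "poly (\<sigma> t) z \<noteq> 0" "z \<noteq> lam t"
  shows "deriv (deformed_p (\<sigma> t) (\<tau> t) (lam t)) z
    = (poly (pderiv (\<tau> t)) z * poly (\<sigma> t) z - poly (\<tau> t) z * poly (pderiv (\<sigma> t)) z)
        / (poly (\<sigma> t) z)\<^sup>2 + 1 / (z - lam t)\<^sup>2"
  unfolding deformed_p_def using assms
  by (intro DERIV_imp_deriv) (auto intro!: derivative_eq_intros simp: power2_eq_square)

lemma deformed_p_deriv_t:
  assumes "poly (\<sigma> t) z \<noteq> 0" "z \<noteq> lam t"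
  shows "deriv (\<lambda>u. deformed_p (\<sigma> u) (\<tau> u) (lam u) z) t
    = deriv (\<lambda>u. poly (\<tau> u) z / poly (\<sigma> u) z) t - deriv lam t / (z - lam t)\<^sup>2"
proof -
  have "((\<lambda>u. poly (\<tau> u) z / poly (\<sigma> u) z) has_field_derivative
      deriv (\<lambda>u. poly (\<tau> u) z / poly (\<sigma> u) z) t) (at t)"
    using tau_over_sigma_param_deriv[OF assms(1)] DERIV_imp_deriv by metis
  moreover have "((\<lambda>u. 1 / (z - lam u)) has_field_derivative deriv lam t / (z - lam t)\<^sup>2) (at t)"
    using assms(2) lam_deriv by (auto intro!: derivative_eq_intros simp: power2_eq_square)
  ultimately show ?thesis
    unfolding deformed_p_def by (intro DERIV_imp_deriv DERIV_diff)
qed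

lemma deformed_q_deriv_z:
  assumes "poly (\<sigma> t) z \<noteq> 0" "z \<noteq> lam t"
  defines "Q \<equiv> \<eta> t z - \<eta> t (lam t) - mu t * (poly (\<tau> t) (lam t) - poly (pderiv (\<sigma> t)) (lam t))
      - (mu t)\<^sup>2 * poly (\<sigma> t) (lam t) + mu t * poly (\<sigma> t) (lam t) / (z - lam t)"
  shows "deriv (deformed_q (\<sigma> t) (\<tau> t) (\<eta> t) (lam t) (mu t)) z
    = (deriv (\<eta> t) z - mu t * poly (\<sigma> t) (lam t) / (z - lam t)\<^sup>2) / poly (\<sigma> t) z
      - poly (pderiv (\<sigma> t)) z * Q / (poly (\<sigma> t) z)\<^sup>2"
proof -
  let ?Q = "\<lambda>z. \<eta> t z - \<eta> t (lam t) - mu t * (poly (\<tau> t) (lam t) - poly (pderiv (\<sigma> t)) (lam t))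
      - (mu t)\<^sup>2 * poly (\<sigma> t) (lam t) + mu t * poly (\<sigma> t) (lam t) / (z - lam t)"
  have "(?Q has_field_derivative deriv (\<eta> t) z - mu t * poly (\<sigma> t) (lam t) / (z - lam t)\<^sup>2) (at z)"
    using assms(2) eta_has_deriv[OF assms(1)]
    by (auto intro!: derivative_eq_intros simp: power2_eq_square)
  then show ?thesis
    unfolding deformed_q_def Q_def using assms(1)
    by (intro DERIV_imp_deriv)
      (auto intro!: derivative_eq_intros simp: divide_simps power2_eq_square)
qed

lemma deformed_q_deriv_t:
  assumes "poly (\<sigma> t) z \<noteq> 0" "z \<noteq> lam t"
  defines "l \<equiv> lam t" and "y \<equiv> mu t" and "l' \<equiv> deriv lam t" and "y' \<equiv> deriv mu t"
    and "V \<equiv> poly (\<tau> t) (lam t) - poly (pderiv (\<sigma> t)) (lam t)"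
  defines "Q \<equiv> \<eta> t z - \<eta> t l - y * V - y\<^sup>2 * poly (\<sigma> t) l + y * poly (\<sigma> t) l / (z - l)"
    and "V' \<equiv> (poly \<tau>d l + poly (pderiv (\<tau> t)) l * l')
      - (poly (pderiv \<sigma>d) l + poly (pderiv (pderiv (\<sigma> t))) l * l')"
    and "s0' \<equiv> poly \<sigma>d l + poly (pderiv (\<sigma> t)) l * l'"
  shows "deriv (\<lambda>u. deformed_q (\<sigma> u) (\<tau> u) (\<eta> u) (lam u) (mu u) z) t
    = (deriv (\<lambda>u. \<eta> u z) t - deriv (\<lambda>u. \<eta> u l) t - deriv (\<eta> t) l * l' - (y' * V + y * V')
        - (2 * y * y' * poly (\<sigma> t) l + y\<^sup>2 * s0')
        + ((y' * poly (\<sigma> t) l + y * s0') / (z - l) + y * poly (\<sigma> t) l * l' / (z - l)\<^sup>2))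
          / poly (\<sigma> t) z
      - poly \<sigma>d z / poly (\<sigma> t) z * Q / poly (\<sigma> t) z"
proof -
  have d: "((\<lambda>u. \<eta> u z) has_field_derivative deriv (\<lambda>u. \<eta> u z) t) (at t)"
    "((\<lambda>u. poly (\<sigma> u) z) has_field_derivative poly \<sigma>d z) (at t)"
    "((\<lambda>u. \<eta> u (lam u)) has_field_derivative deriv (\<lambda>u. \<eta> u l) t + deriv (\<eta> t) l * l') (at t)"
    "((\<lambda>u. poly (\<tau> u) (lam u)) has_field_derivative
        poly \<tau>d l + poly (pderiv (\<tau> t)) l * l') (at t)"
    "((\<lambda>u. poly (\<sigma> u) (lam u)) has_field_derivative s0') (at t)"
    "((\<lambda>u. poly (pderiv (\<sigma> u)) (lam u)) has_field_derivative
        poly (pderiv \<sigma>d) l + poly (pderiv (pderiv (\<sigma> t))) l * l') (at t)"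
    "(lam has_field_derivative l') (at t)" "(mu has_field_derivative y') (at t)"
    using eta_total_deriv[of "\<lambda>_. z", OF DERIV_const] assms(1)
      families(1)[OF DERIV_const[of z]] eta_total_deriv[OF lam_deriv sigma_lam]
      families(2)[OF lam_deriv] families(1)[OF lam_deriv] sigma_pderiv_family[OF lam_deriv]
      lam_deriv mu_deriv
    unfolding l_def l'_def y'_def s0'_def by simp_all
  have "((\<lambda>u. \<eta> u z - \<eta> u (lam u) - mu u * (poly (\<tau> u) (lam u) - poly (pderiv (\<sigma> u)) (lam u))
      - (mu u)\<^sup>2 * poly (\<sigma> u) (lam u) + mu u * poly (\<sigma> u) (lam u) / (z - lam u))
     has_field_derivative
      (deriv (\<lambda>u. \<eta> u z) t - deriv (\<lambda>u. \<eta> u l) t - deriv (\<eta> t) l * l' - (y' * V + y * V')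
        - (2 * y * y' * poly (\<sigma> t) l + y\<^sup>2 * s0')
        + ((y' * poly (\<sigma> t) l + y * s0') / (z - l) + y * poly (\<sigma> t) l * l' / (z - l)\<^sup>2))) (at t)"
    using assms(2) unfolding V_def V'_def
    by (auto intro!: derivative_eq_intros d simp: l_def[symmetric] y_def[symmetric])
      (simp add: divide_simps power2_eq_square)
  then show ?thesis
    unfolding deformed_q_def Q_def V_def using assms(1,2) d(2)
    by (intro DERIV_imp_deriv)
      (auto intro!: derivative_eq_intros
        simp: l_def[symmetric] y_def[symmetric] divide_simps power2_eq_square)
qed

text \<open>
  In both cases the Hamiltonian has this shape; only the coefficient \<open>K\<close> of \<open>\<mu>\<close> differs.
\<close>

lemma hamilton_equations_at:
  assumes K: "(K has_field_derivative K') (at (lam t))"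
  shows "hamilton_equations {t} (\<lambda>_ l y. m * (\<eta> t l + K l * y + poly (\<sigma> t) l * y\<^sup>2)) lam mu \<longleftrightarrow>
    deriv lam t = m * (K (lam t) + 2 * poly (\<sigma> t) (lam t) * mu t) \<and>
    deriv mu t = - (m * (deriv (\<eta> t) (lam t) + K' * mu t
                         + poly (pderiv (\<sigma> t)) (lam t) * (mu t)\<^sup>2))"
proof -
  have "deriv (\<lambda>y. m * (\<eta> t (lam t) + K (lam t) * y + poly (\<sigma> t) (lam t) * y\<^sup>2)) (mu t)
      = m * (K (lam t) + 2 * poly (\<sigma> t) (lam t) * mu t)"
    by (intro DERIV_imp_deriv) (auto intro!: derivative_eq_intros)
  moreover have "deriv (\<lambda>l. m * (\<eta> t l + K l * mu t + poly (\<sigma> t) l * (mu t)\<^sup>2)) (lam t)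
      = m * (deriv (\<eta> t) (lam t) + K' * mu t + poly (pderiv (\<sigma> t)) (lam t) * (mu t)\<^sup>2)"
    using K eta_has_deriv[OF sigma_lam]
    by (intro DERIV_imp_deriv) (auto intro!: derivative_eq_intros)
  ultimately show ?thesis
    unfolding hamilton_equations_def by simp
qed

end

section \<open>The singular point as a point of the projective line\<close>

text \<open>
  For \<open>p\<close> of degree at most two and \<open>\<kappa> \<noteq> 0\<close> this is \<open>\<kappa>\<^sup>2 p (l - 1/\<kappa>)\<close>, and for \<open>\<kappa> = 0\<close> it is the
  coefficient of \<open>z\<^sup>2\<close>: the value of the binary quadratic form belonging to \<open>p\<close> at the point
  \<open>l - 1/\<kappa>\<close> of the projective line.
\<close>

definition pole_value :: "complex poly \<Rightarrow> complex \<Rightarrow> complex \<Rightarrow> complex" where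
  "pole_value p l \<kappa> = poly (pderiv (pderiv p)) l / 2 - \<kappa> * poly (pderiv p) l + \<kappa>\<^sup>2 * poly p l"

text \<open>
  The hypotheses of both cases in terms of \<open>\<kappa>\<close>, the reciprocal of \<open>\<lambda> - s\<close>. For a finite singular
  point \<open>s\<close>, the factor \<open>1 + \<kappa> (z - \<lambda>)\<close> is \<open>(z - s) / (\<lambda> - s)\<close> and \<open>g = (\<lambda> - s) \<rho>\<close>; for \<open>\<kappa> = 0\<close>
  the singular point is infinity and \<open>g = \<sigma>\<close>. This normalisation gives \<open>g(\<lambda>) = \<sigma>(\<lambda>)\<close> and the
  common form \<open>a = m g(z) / (z - \<lambda>)\<close>, \<open>b = - m g(\<lambda>) \<mu> / (z - \<lambda>)\<close>. The parameter \<open>t\<close> is fixed, so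
  \<open>m\<close>, \<open>\<kappa>\<close> and \<open>g\<close> are constants.
\<close>

locale pole_deformation = deformed_heun +
  fixes m \<kappa> :: complex and g :: "complex poly"
  assumes degree_g: "degree g \<le> 2"
    and sigma_factor: "\<sigma> t = [:1 - \<kappa> * lam t, \<kappa>:] * g"
    and tau_condition: "\<And>z. poly (\<sigma> t) z \<noteq> 0 \<Longrightarrow>
      deriv (\<lambda>u. poly (\<tau> u) z / poly (\<sigma> u) z) t
        = m * pole_value (\<tau> t) (lam t) \<kappa> / (1 + \<kappa> * (z - lam t))\<^sup>2"
    and eta_condition: "\<And>z. poly (\<sigma> t) z \<noteq> 0 \<Longrightarrow> z \<noteq> lam t \<Longrightarrow>
      deriv (\<lambda>u. poly (\<sigma> u) z) t / poly (\<sigma> t) z * (\<eta> t z - \<eta> t (lam t))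
          - (deriv (\<lambda>u. \<eta> u z) t - deriv (\<lambda>u. \<eta> u (lam t)) t)
        = m * ((\<eta> t z - \<eta> t (lam t)) * \<kappa> * poly g z / ((z - lam t) * (1 + \<kappa> * (z - lam t)))
               - deriv (\<eta> t) (lam t) * \<kappa> * poly g (lam t))
          + m / (z - lam t)\<^sup>2 *
            (2 * (poly g z * \<eta> t z) - 2 * (poly g (lam t) * \<eta> t (lam t))
             - (deriv (\<lambda>x. poly g x * \<eta> t x) z + deriv (\<lambda>x. poly g x * \<eta> t x) (lam t))
               * (z - lam t))"
    and sigma_condition: "\<And>z. poly (\<sigma> t) z \<noteq> 0 \<Longrightarrow>
      deriv (\<lambda>u. poly (\<sigma> u) z) t / poly (\<sigma> t) z
          - deriv (\<lambda>u. poly (\<sigma> u) (lam t)) t / poly (\<sigma> t) (lam t)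
        = m * \<kappa> * pole_value g (lam t) \<kappa> * (z - lam t) / (1 + \<kappa> * (z - lam t))"
begin

abbreviation "l \<equiv> lam t"
abbreviation "y \<equiv> mu t"
abbreviation "g0 \<equiv> poly g l"
abbreviation "g1 \<equiv> poly (pderiv g) l"
abbreviation "g2 \<equiv> poly (pderiv (pderiv g)) l / 2"
abbreviation "t0 \<equiv> poly (\<tau> t) l"
abbreviation "t1 \<equiv> poly (pderiv (\<tau> t)) l"
abbreviation "t2 \<equiv> poly (pderiv (pderiv (\<tau> t))) l / 2"

lemma sigma_value: "poly (\<sigma> t) z = (1 + \<kappa> * (z - l)) * poly g z"
  unfolding sigma_factor by (simp add: algebra_simps)

lemma sigma_pderiv: "poly (pderiv (\<sigma> t)) z = \<kappa> * poly g z + (1 + \<kappa> * (z - l)) * poly (pderiv g) z"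
  unfolding sigma_factor pderiv_mult by (simp add: pderiv_pCons algebra_simps)

lemma sigma_pderiv2: "poly (pderiv (pderiv (\<sigma> t))) l = 2 * (g2 + \<kappa> * g1)"
  unfolding sigma_factor pderiv_mult pderiv_add by (simp add: pderiv_pCons algebra_simps)

lemma g0_nonzero: "g0 \<noteq> 0"
  using sigma_lam sigma_value[of l] by simp

abbreviation "c \<equiv> poly \<sigma>d l / g0"

text \<open>
  The condition on \<open>\<sigma>\<close>, with the denominators cleared, holds off the zeros of \<open>\<sigma>\<close>, hence as an
  identity of polynomials. It may therefore be differentiated in \<open>z\<close> and evaluated at \<open>\<lambda>\<close>.
\<close>

lemma sigma_dot: "\<sigma>d = smult c (\<sigma> t) + smult (m * \<kappa> * pole_value g l \<kappa>) ([:- l, 1:] * g)"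
  (is "_ = ?R")
proof -
  have "poly ((\<sigma>d - ?R) * \<sigma> t) z = 0" for z
  proof (cases "poly (\<sigma> t) z = 0")
    case False
    then have nz: "1 + \<kappa> * (z - l) \<noteq> 0" "poly g z \<noteq> 0"
      using sigma_value[of z] by auto
    have "poly \<sigma>d z / poly (\<sigma> t) z = c + m * \<kappa> * pole_value g l \<kappa> * (z - l) / (1 + \<kappa> * (z - l))"
      using sigma_condition[OF False] unfolding sigma_param_deriv sigma_value[of l]
      by (simp add: algebra_simps)
    then have "poly \<sigma>d z = poly (\<sigma> t) z * (c + m * \<kappa> * pole_value g l \<kappa> * (z - l) / (1 + \<kappa> * (z - l)))"
      using False by (simp add: divide_eq_eq mult.commute)
    also have "\<dots> = c * poly (\<sigma> t) z + m * \<kappa> * pole_value g l \<kappa> * (z - l) * poly g z"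
      unfolding sigma_value using nz by (simp add: divide_simps) algebra
    also have "\<dots> = poly ?R z" by (simp add: algebra_simps)
    finally show ?thesis by simp
  qed simp
  then have "(\<sigma>d - ?R) * \<sigma> t = 0" using poly_all_0_iff_0 by blast
  moreover have "\<sigma> t \<noteq> 0" using sigma_lam by auto
  ultimately show ?thesis by simp
qed

lemma sigma_dot_pderiv: "poly (pderiv \<sigma>d) l = c * (g1 + \<kappa> * g0) + m * \<kappa> * pole_value g l \<kappa> * g0"
  by (subst sigma_dot, unfold pderiv_add pderiv_smult pderiv_mult)
    (simp add: sigma_pderiv pderiv_pCons algebra_simps)

lemma tau_dot: "poly \<tau>d l = m * pole_value (\<tau> t) l \<kappa> * g0 + c * t0"
proof -
  have "(poly \<tau>d l * poly (\<sigma> t) l - t0 * poly \<sigma>d l) / (poly (\<sigma> t) l)\<^sup>2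
      = m * pole_value (\<tau> t) l \<kappa>"
    using tau_condition[OF sigma_lam] DERIV_imp_deriv[OF tau_over_sigma_param_deriv[OF sigma_lam]]
    by simp
  then show ?thesis
    using g0_nonzero unfolding sigma_value[of l] by (simp add: divide_simps) algebra
qed

lemma rational_derivs:
  fixes k :: complex and h :: "complex poly"
  assumes "z \<noteq> l"
  shows "deriv (\<lambda>z. k * poly h z / (z - l)) z
      = k * (poly (pderiv h) z / (z - l) - poly h z / (z - l)\<^sup>2)"
    and "deriv (deriv (\<lambda>z. k * poly h z / (z - l))) z
      = k * (poly (pderiv (pderiv h)) z / (z - l) - 2 * poly (pderiv h) z / (z - l)\<^sup>2
             + 2 * poly h z / (z - l) ^ 3)"
proof -
  have *: "deriv (\<lambda>z. k * poly h z / (z - l)) z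
      = k * (poly (pderiv h) z / (z - l) - poly h z / (z - l)\<^sup>2)" if "z \<noteq> l" for z
    using that by (intro DERIV_imp_deriv)
      (auto intro!: derivative_eq_intros simp: divide_simps power2_eq_square, simp add: algebra_simps)
  show "deriv (\<lambda>z. k * poly h z / (z - l)) z
      = k * (poly (pderiv h) z / (z - l) - poly h z / (z - l)\<^sup>2)"
    using *[OF assms] .
  have "\<forall>\<^sub>F z in nhds z. deriv (\<lambda>z. k * poly h z / (z - l)) z
      = k * (poly (pderiv h) z / (z - l) - poly h z / (z - l)\<^sup>2)"
    using eventually_nhds_in_open[of "- {l}" z] assms
    by (auto simp: open_Compl * elim!: eventually_mono)
  then have "deriv (deriv (\<lambda>z. k * poly h z / (z - l))) z
      = deriv (\<lambda>z. k * (poly (pderiv h) z / (z - l) - poly h z / (z - l)\<^sup>2)) z"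
    by (intro deriv_cong_ev refl)
  also have "\<dots> = k * (poly (pderiv (pderiv h)) z / (z - l) - 2 * poly (pderiv h) z / (z - l)\<^sup>2
             + 2 * poly h z / (z - l) ^ 3)"
  proof -
    define X where "X = z - l"
    then have "z = l + X" "X \<noteq> 0" using assms by auto
    then show ?thesis
      by (intro DERIV_imp_deriv)
        (auto intro!: derivative_eq_intros, simp add: divide_simps eval_nat_numeral,
          simp add: algebra_simps)
  qed
  finally show "deriv (deriv (\<lambda>z. k * poly h z / (z - l))) z
      = k * (poly (pderiv (pderiv h)) z / (z - l) - 2 * poly (pderiv h) z / (z - l)\<^sup>2
             + 2 * poly h z / (z - l) ^ 3)" .
qed

abbreviation "a z \<equiv> m * poly g z / (z - l)"
abbreviation "b z \<equiv> - (m * poly g l * y / (z - l))"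
abbreviation "p \<equiv> deformed_p (\<sigma> t) (\<tau> t) l"
abbreviation "q \<equiv> deformed_q (\<sigma> t) (\<tau> t) (\<eta> t) l y"
abbreviation "lam_rhs \<equiv> m * (t0 - g1 + 2 * g0 * y)"
abbreviation "mu_rhs \<equiv> m * (deriv (\<eta> t) l + (t1 - \<kappa> * g1 - 2 * g2) * y + (g1 + \<kappa> * g0) * y\<^sup>2)"

lemma b_derivs:
  assumes "z \<noteq> l"
  shows "deriv b z = m * g0 * y / (z - l)\<^sup>2" "deriv (deriv b) z = - 2 * (m * g0 * y) / (z - l) ^ 3"
  using rational_derivs[OF assms, of "- (m * g0 * y)" "1"] by simp_all

lemma first_condition:
  assumes "poly (\<sigma> t) z \<noteq> 0" "z \<noteq> l"
  shows "deriv (\<lambda>u. deformed_p (\<sigma> u) (\<tau> u) (lam u) z) t - a z * deriv p z + 2 * deriv b z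
      - p z * deriv a z + deriv (deriv a) z = (lam_rhs - deriv lam t) / (z - l)\<^sup>2"
proof -
  have nz: "z - l \<noteq> 0" "1 + \<kappa> * (z - l) \<noteq> 0" "poly g z \<noteq> 0"
    using assms sigma_value[of z] by auto
  show ?thesis
    unfolding deformed_p_deriv_t[OF assms] deformed_p_deriv_z[OF assms] b_derivs[OF assms(2)]
      rational_derivs[OF assms(2)] tau_condition[OF assms(1)]
    unfolding pole_value_def deformed_p_def sigma_value sigma_pderiv
    using first_condition_algebra[of "z - l" \<kappa> g0 g1 g2 m t2 t1 t0 "deriv lam t" y,
        folded taylor_quadratic[OF degree_g] taylor_quadratic[OF degrees(2)[OF t_in]]] nz
    by (simp add: taylor_quadratic(3)[OF degree_g, of z l])
qed

text \<open>
  The derivative of \<open>\<mu>\<close> enters the second condition only through \<open>\<partial>q/\<partial>\<mu>\<close>, which explains the first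
  factor.
\<close>

lemma second_condition:
  assumes "poly (\<sigma> t) z \<noteq> 0" "z \<noteq> l" and lam: "deriv lam t = lam_rhs"
  shows "deriv (\<lambda>u. deformed_q (\<sigma> u) (\<tau> u) (\<eta> u) (lam u) (mu u) z) t + p z * deriv b z
      - 2 * q z * deriv a z - a z * deriv q z + deriv (deriv b) z
    = (g0 / (z - l) - (t0 - (g1 + \<kappa> * g0)) - 2 * y * g0) / poly (\<sigma> t) z
        * (deriv mu t + mu_rhs)"
proof -
  have nz: "z - l \<noteq> 0" "1 + \<kappa> * (z - l) \<noteq> 0" "poly g z \<noteq> 0"
    using assms sigma_value[of z] by auto
  have geta: "deriv (\<lambda>x. poly g x * \<eta> t x) w = poly (pderiv g) w * \<eta> t w + poly g w * deriv (\<eta> t) w"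
    if "poly (\<sigma> t) w \<noteq> 0" for w
    using eta_has_deriv[OF that] by (intro DERIV_imp_deriv) (auto intro!: derivative_eq_intros)
  note T = taylor_quadratic(1,2)[OF degree_g, of z l] taylor_quadratic(1)[OF degrees(2)[OF t_in], of z l]
  have sd: "deriv (\<lambda>u. poly (\<sigma> u) z) t / poly (\<sigma> t) z = c + m * \<kappa> * pole_value g l \<kappa> * (z - l) / (1 + \<kappa> * (z - l))"
    using sigma_condition[OF assms(1)] unfolding sigma_param_deriv sigma_value[of l]
    by (simp add: algebra_simps)
  have V': "poly \<tau>d l + t1 * lam_rhs
      - (poly (pderiv \<sigma>d) l + poly (pderiv (pderiv (\<sigma> t))) l * lam_rhs)
     = (m * pole_value (\<tau> t) l \<kappa> * g0 + c * t0 + t1 * lam_rhs)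
       - (c * (g1 + \<kappa> * g0) + m * \<kappa> * pole_value g l \<kappa> * g0 + 2 * (g2 + \<kappa> * g1) * lam_rhs)"
    unfolding tau_dot sigma_dot_pderiv sigma_pderiv2 ..
  have s0': "poly \<sigma>d l + (g1 + \<kappa> * g0) * lam_rhs = c * g0 + (g1 + \<kappa> * g0) * lam_rhs"
    using g0_nonzero by simp
  note R = second_condition_algebra[where x = "z - l" and \<kappa> = \<kappa> and ?g0.0 = g0 and ?g1.0 = g1 and ?g2.0 = g2
      and ?t0.0 = t0 and ?t1.0 = t1 and ?t2.0 = t2 and y' = "deriv mu t", folded T, OF nz
      eta_condition[OF assms(1,2), unfolded geta[OF assms(1)] geta[OF sigma_lam]]
      sd[unfolded pole_value_def] V'[unfolded pole_value_def] s0']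
  have vals: "poly (\<sigma> t) l = g0" "poly (pderiv (\<sigma> t)) l = g1 + \<kappa> * g0"
    by (simp_all add: sigma_value sigma_pderiv)
  have pz: "p z = poly (\<tau> t) z / ((1 + \<kappa> * (z - l)) * poly g z) - 1 / (z - l)"
    unfolding deformed_p_def sigma_value ..
  have qz: "q z = (\<eta> t z - \<eta> t l - y * (t0 - (g1 + \<kappa> * g0)) - y\<^sup>2 * g0 + y * g0 / (z - l))
       / ((1 + \<kappa> * (z - l)) * poly g z)"
    unfolding deformed_q_def sigma_value[of z] vals by simp
  show ?thesis
    unfolding deformed_q_deriv_t[OF assms(1,2)] deformed_q_deriv_z[OF assms(1,2)]
      b_derivs[OF assms(2)] rational_derivs(1)[OF assms(2)] pz qz lam
    unfolding vals
    unfolding sigma_value[of z] sigma_pderiv[of z]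
    using R unfolding sigma_value[of z] sigma_param_deriv by simp
qed

text \<open>
  For a suitable constant \<open>C\<close>, the expression \<open>g0 / (z - \<lambda>) - C\<close> is \<open>\<sigma> \<partial>q/\<partial>\<mu>\<close>. Its pole at \<open>\<lambda>\<close>, due to
  \<open>\<sigma>(\<lambda>) \<noteq> 0\<close>, keeps it from vanishing identically off the finitely many singular points.
\<close>

lemma ex_regular_point: "\<exists>z. poly (\<sigma> t) z \<noteq> 0 \<and> z \<noteq> l \<and> g0 / (z - l) - C \<noteq> 0"
proof -
  let ?f = "\<sigma> t * [:- l, 1:] * [:g0 + C * l, - C:]"
  have "poly (\<sigma> t) l \<noteq> 0" "poly [:g0 + C * l, - C:] l \<noteq> 0"
    using sigma_lam g0_nonzero by simp_all
  then have "\<sigma> t \<noteq> 0" "[:g0 + C * l, - C:] \<noteq> 0"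
    by force+
  then have "?f \<noteq> 0" by (metis mult_eq_0_iff one_neq_zero pCons_eq_0_iff)
  then obtain z where z: "poly ?f z \<noteq> 0"
    using poly_all_0_iff_0 by blast
  moreover have "poly ?f z = poly (\<sigma> t) z * (z - l) * (g0 - C * (z - l))"
    by (simp add: algebra_simps)
  ultimately have "g0 - C * (z - l) \<noteq> 0" "z - l \<noteq> 0" "poly (\<sigma> t) z \<noteq> 0"
    by auto
  then show ?thesis
    by (intro exI[of _ z]) (auto simp: divide_simps)
qed

lemma hamilton_iff_compatible:
  "deriv lam t = lam_rhs \<and> deriv mu t = - mu_rhs \<longleftrightarrow>
   deformed_compatibility {t} \<sigma> \<tau> \<eta> lam mu (\<lambda>_. a) (\<lambda>_. b)"
  (is "?H \<longleftrightarrow> ?C")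
proof
  assume ?H
  then show ?C
    unfolding deformed_compatibility_def compatibility_conditions_def
    using first_condition second_condition by simp
next
  assume ?C
  then have compat:
    "deriv (\<lambda>u. deformed_p (\<sigma> u) (\<tau> u) (lam u) z) t - a z * deriv p z + 2 * deriv b z
      - p z * deriv a z + deriv (deriv a) z = 0"
    "deriv (\<lambda>u. deformed_q (\<sigma> u) (\<tau> u) (\<eta> u) (lam u) (mu u) z) t + p z * deriv b z
      - 2 * q z * deriv a z - a z * deriv q z + deriv (deriv b) z = 0"
    if "poly (\<sigma> t) z \<noteq> 0" "z \<noteq> l" for z
    using that unfolding deformed_compatibility_def compatibility_conditions_def by blast+
  obtain z where z: "poly (\<sigma> t) z \<noteq> 0" "z \<noteq> l"
    and factor: "g0 / (z - l) - ((t0 - (g1 + \<kappa> * g0)) + 2 * y * g0) \<noteq> 0"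
    using ex_regular_point by blast
  have lam: "deriv lam t = lam_rhs"
    using compat(1)[OF z] z(2) unfolding first_condition[OF z] by simp
  have "deriv mu t + mu_rhs = 0"
    using compat(2)[OF z] z(1) factor unfolding second_condition[OF z lam]
    by (simp add: diff_diff_eq)
  with lam show ?H by (simp add: eq_neg_iff_add_eq_0)
qed

end

section \<open>Finite singular point and singular point at infinity\<close>

text \<open>
  Under \<open>\<kappa> = 1 / w\<close> with \<open>w = \<lambda> - s\<close>, the value \<open>pole_value\<close> of a quadratic is its value at \<open>s\<close>
  divided by \<open>w\<^sup>2\<close>. All powers of \<open>w\<close> then cancel against those in \<open>g = w \<rho>\<close> and in
  \<open>1 + \<kappa> (z - \<lambda>) = (z - s) / w\<close>.
\<close>

lemma finite_pole_case:
  assumes dh: "deformed_heun T \<sigma> \<tau> \<pi> \<eta> lam mu t"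
    and factor: "\<sigma> t = [:- s, 1:] * r"
    and tau_cond: "\<And>z. poly (\<sigma> t) z \<noteq> 0 \<Longrightarrow>
      deriv (\<lambda>u. poly (\<tau> u) z / poly (\<sigma> u) z) t = m * poly (\<tau> t) s / (z - s)\<^sup>2"
    and eta_cond: "\<And>l z. poly (\<sigma> t) l \<noteq> 0 \<Longrightarrow> poly (\<sigma> t) z \<noteq> 0 \<Longrightarrow> z \<noteq> l \<Longrightarrow>
      deriv (\<lambda>u. poly (\<sigma> u) z) t / poly (\<sigma> t) z * (\<eta> t z - \<eta> t l)
           - deriv (\<lambda>u. \<eta> u z) t + deriv (\<lambda>u. \<eta> u l) t
         = m * ((\<eta> t z - \<eta> t l) * (l - s) * poly r z / ((z - l) * (z - s))
                  - deriv (\<eta> t) l * poly r l)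
           + m * (l - s) / (z - l)\<^sup>2 *
             (2 * (poly r z * \<eta> t z) - 2 * (poly r l * \<eta> t l)
              - (deriv (\<lambda>x. poly r x * \<eta> t x) z + deriv (\<lambda>x. poly r x * \<eta> t x) l)
                * (z - l))"
    and sigma_cond: "\<And>l z. poly (\<sigma> t) l \<noteq> 0 \<Longrightarrow> poly (\<sigma> t) z \<noteq> 0 \<Longrightarrow>
      deriv (\<lambda>u. poly (\<sigma> u) z) t / poly (\<sigma> t) z - deriv (\<lambda>u. poly (\<sigma> u) l) t / poly (\<sigma> t) l
         = m * poly r s * ((z - l) / ((z - s) * (l - s)))"
  shows "hamilton_equations {t}
      (\<lambda>_ l y. m * (\<eta> t l + (poly (\<tau> t) l - (l - s) * poly (pderiv r) l) * y
                         + poly (\<sigma> t) l * y\<^sup>2)) lam mu \<longleftrightarrow>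
    deformed_compatibility {t} \<sigma> \<tau> \<eta> lam mu
         (\<lambda>_ z. m * (lam t - s) * poly r z / (z - lam t))
         (\<lambda>_ z. - (m * (lam t - s) * poly r (lam t) * mu t / (z - lam t)))"
proof -
  interpret deformed_heun T \<sigma> \<tau> \<pi> \<eta> lam mu t by fact
  define w where "w = lam t - s"
  have sigma_r: "poly (\<sigma> t) z = (z - s) * poly r z" for z
    unfolding factor by (simp add: algebra_simps)
  have w: "w \<noteq> 0" and s: "s = lam t - w" using sigma_lam sigma_r unfolding w_def by auto
  have deg_r: "degree r \<le> 2"
  proof -
    have "r \<noteq> 0" using sigma_lam sigma_r by auto
    then have "degree (\<sigma> t) = 1 + degree r"
      unfolding factor by (subst degree_mult_eq) auto
    then show ?thesis using degrees(1)[OF t_in] by simp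
  qed
  have shift: "1 + 1 / w * (z - lam t) = (z - s) / w" for z
    using w unfolding s by (simp add: field_simps)
  have pole: "pole_value h (lam t) (1 / w) = poly h s / w\<^sup>2" if "degree h \<le> 2" for h
    unfolding pole_value_def taylor_quadratic(1)[OF that, of s "lam t"]
    using w unfolding s by (simp add: divide_simps power2_eq_square) (simp add: algebra_simps)
  interpret pole_deformation T \<sigma> \<tau> \<pi> \<eta> lam mu t m "1 / w" "smult w r"
  proof
    show "degree (smult w r) \<le> 2" using deg_r w by simp
    show "\<sigma> t = [:1 - 1 / w * lam t, 1 / w:] * smult w r"
      unfolding factor s using w
      by (intro poly_eq_poly_eq_iff[THEN iffD1] ext) (simp add: field_simps)
  next
    fix z assume z: "poly (\<sigma> t) z \<noteq> 0"
    then have zs: "z - s \<noteq> 0" using sigma_r by auto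
    show "deriv (\<lambda>u. poly (\<tau> u) z / poly (\<sigma> u) z) t
        = m * pole_value (\<tau> t) (lam t) (1 / w) / (1 + 1 / w * (z - lam t))\<^sup>2"
      unfolding tau_cond[OF z] shift pole[OF degrees(2)[OF t_in]]
      using w zs by (simp add: power_divide)
    show "deriv (\<lambda>u. poly (\<sigma> u) z) t / poly (\<sigma> t) z
          - deriv (\<lambda>u. poly (\<sigma> u) (lam t)) t / poly (\<sigma> t) (lam t)
        = m * (1 / w) * pole_value (smult w r) (lam t) (1 / w) * (z - lam t)
            / (1 + 1 / w * (z - lam t))"
      unfolding sigma_cond[OF sigma_lam z] shift pole[OF order.trans[OF degree_smult_le deg_r]]
        w_def[symmetric]
      using w zs by (simp add: divide_simps power2_eq_square)
  next
    fix z assume z: "poly (\<sigma> t) z \<noteq> 0" "z \<noteq> lam t"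
    have zs: "z - s \<noteq> 0" using sigma_r z by auto
    have geta: "deriv (\<lambda>x. poly (smult w r) x * \<eta> t x) v = w * deriv (\<lambda>x. poly r x * \<eta> t x) v"
      if "poly (\<sigma> t) v \<noteq> 0" for v
    proof -
      have "((\<lambda>x. poly r x * \<eta> t x) has_field_derivative
          poly (pderiv r) v * \<eta> t v + poly r v * deriv (\<eta> t) v) (at v)"
        using eta_has_deriv[OF that] by (auto intro!: derivative_eq_intros)
      from DERIV_cmult[OF this, of w] this show ?thesis
        by (simp add: DERIV_imp_deriv mult.assoc)
    qed
    show "deriv (\<lambda>u. poly (\<sigma> u) z) t / poly (\<sigma> t) z * (\<eta> t z - \<eta> t (lam t))
          - (deriv (\<lambda>u. \<eta> u z) t - deriv (\<lambda>u. \<eta> u (lam t)) t)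
        = m * ((\<eta> t z - \<eta> t (lam t)) * (1 / w) * poly (smult w r) z
                 / ((z - lam t) * (1 + 1 / w * (z - lam t)))
               - deriv (\<eta> t) (lam t) * (1 / w) * poly (smult w r) (lam t))
          + m / (z - lam t)\<^sup>2 *
            (2 * (poly (smult w r) z * \<eta> t z) - 2 * (poly (smult w r) (lam t) * \<eta> t (lam t))
             - (deriv (\<lambda>x. poly (smult w r) x * \<eta> t x) z
                + deriv (\<lambda>x. poly (smult w r) x * \<eta> t x) (lam t))
               * (z - lam t))"
      unfolding diff_diff_eq2 diff_add_eq[symmetric] eta_cond[OF sigma_lam z] shift
        geta[OF z(1)] geta[OF sigma_lam] w_def[symmetric]
      using w zs z(2) by (simp add: divide_simps) algebra
  qed
  have K: "((\<lambda>l. poly (\<tau> t) l - (l - s) * poly (pderiv r) l) has_field_derivative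
      poly (pderiv (\<tau> t)) (lam t) - poly (pderiv r) (lam t)
        - w * poly (pderiv (pderiv r)) (lam t)) (at (lam t))"
    unfolding w_def by (auto intro!: derivative_eq_intros)
  show ?thesis
    unfolding hamilton_equations_at[OF K] w_def[symmetric]
    using hamilton_iff_compatible w sigma_value[of "lam t"] sigma_pderiv[of "lam t"]
    by (simp add: pderiv_smult mult.assoc add.commute)
qed

text \<open>
  With \<open>\<kappa> = 0\<close> the condition on \<open>\<sigma>\<close> only says that \<open>\<partial>\<^sub>t \<sigma> / \<sigma>\<close> is constant in \<open>z\<close>, which holds
  because \<open>\<sigma>\<close> is constant in \<open>t\<close>.
\<close>

lemma pole_at_infinity_case:
  assumes dh: "deformed_heun T \<sigma> \<tau> \<pi> \<eta> lam mu t"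
    and degs: "degree (\<sigma> t) \<le> 2" "degree (\<pi> t) \<le> 3"
    and const: "\<And>u. u \<in> T \<Longrightarrow> \<sigma> u = \<sigma> t"
    and tau_cond: "\<And>z. poly (\<sigma> t) z \<noteq> 0 \<Longrightarrow>
      deriv (\<lambda>u. poly (\<tau> u) z) t / poly (\<sigma> t) z = m * (poly (pderiv (pderiv (\<tau> t))) z / 2)"
    and eta_cond: "\<And>l z. poly (\<sigma> t) l \<noteq> 0 \<Longrightarrow> poly (\<sigma> t) z \<noteq> 0 \<Longrightarrow>
      deriv (\<lambda>u. \<eta> u z) t - deriv (\<lambda>u. \<eta> u l) t
         = m * (poly (pderiv (pderiv (pderiv (\<pi> t)))) z / 6) * (z - l)"
  shows "hamilton_equations {t}
      (\<lambda>_ l y. m * (\<eta> t l + (poly (\<tau> t) l - poly (pderiv (\<sigma> t)) l) * y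
                         + poly (\<sigma> t) l * y\<^sup>2)) lam mu \<longleftrightarrow>
    deformed_compatibility {t} \<sigma> \<tau> \<eta> lam mu
         (\<lambda>_ z. m * poly (\<sigma> t) z / (z - lam t))
         (\<lambda>_ z. - (m * poly (\<sigma> t) (lam t) * mu t / (z - lam t)))"
proof -
  interpret deformed_heun T \<sigma> \<tau> \<pi> \<eta> lam mu t by fact
  have near: "\<forall>\<^sub>F u in nhds t. \<sigma> u = \<sigma> t"
    using eventually_nhds_in_open[OF open_T t_in] by (rule eventually_mono) (rule const)
  have sd: "deriv (\<lambda>u. poly (\<sigma> u) z) t = 0" for z
  proof -
    have "deriv (\<lambda>u. poly (\<sigma> u) z) t = deriv (\<lambda>u. poly (\<sigma> t) z) t"
      using near by (intro deriv_cong_ev) (auto elim: eventually_mono)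
    then show ?thesis by simp
  qed
  interpret pole_deformation T \<sigma> \<tau> \<pi> \<eta> lam mu t m 0 "\<sigma> t"
  proof
    show "degree (\<sigma> t) \<le> 2" by fact
    show "\<sigma> t = [:1 - 0 * lam t, 0:] * \<sigma> t" by simp
  next
    fix z assume z: "poly (\<sigma> t) z \<noteq> 0"
    have "deriv (\<lambda>u. poly (\<tau> u) z / poly (\<sigma> u) z) t = deriv (\<lambda>u. poly (\<tau> u) z) t / poly (\<sigma> t) z"
      unfolding DERIV_imp_deriv[OF tau_over_sigma_param_deriv[OF z]]
        DERIV_imp_deriv[OF families(2)[OF DERIV_const[of z]]]
      using z sd[of z] unfolding sigma_param_deriv by (simp add: power2_eq_square)
    then show "deriv (\<lambda>u. poly (\<tau> u) z / poly (\<sigma> u) z) t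
        = m * pole_value (\<tau> t) (lam t) 0 / (1 + 0 * (z - lam t))\<^sup>2"
      unfolding tau_cond[OF z] taylor_quadratic(3)[OF degrees(2)[OF t_in], of z "lam t"]
      by (simp add: pole_value_def)
    show "deriv (\<lambda>u. poly (\<sigma> u) z) t / poly (\<sigma> t) z
          - deriv (\<lambda>u. poly (\<sigma> u) (lam t)) t / poly (\<sigma> t) (lam t)
        = m * 0 * pole_value (\<sigma> t) (lam t) 0 * (z - lam t) / (1 + 0 * (z - lam t))"
      unfolding sd by simp
  next
    fix z assume z: "poly (\<sigma> t) z \<noteq> 0" "z \<noteq> lam t"
    have prod: "poly (\<sigma> t) v * \<eta> t v = poly (\<pi> t) v"
      "deriv (\<lambda>x. poly (\<sigma> t) x * \<eta> t x) v = poly (pderiv (\<pi> t)) v"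
      if "poly (\<sigma> t) v \<noteq> 0" for v
    proof -
      have eq: "poly (\<sigma> t) v * \<eta> t v = poly (\<pi> t) v" if "poly (\<sigma> t) v \<noteq> 0" for v
        using eta_eq[OF t_in that] that by simp
      then show "poly (\<sigma> t) v * \<eta> t v = poly (\<pi> t) v" using that .
      have "open {v. poly (\<sigma> t) v \<noteq> 0}"
        by (intro open_Collect_neq continuous_intros)
      then have "\<forall>\<^sub>F x in nhds v. poly (\<sigma> t) x * \<eta> t x = poly (\<pi> t) x"
        using that eq eventually_nhds_in_open[of "{v. poly (\<sigma> t) v \<noteq> 0}" v]
        by (auto elim: eventually_mono)
      then have "deriv (\<lambda>x. poly (\<sigma> t) x * \<eta> t x) v = deriv (poly (\<pi> t)) v"
        by (intro deriv_cong_ev refl)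
      then show "deriv (\<lambda>x. poly (\<sigma> t) x * \<eta> t x) v = poly (pderiv (\<pi> t)) v"
        using DERIV_imp_deriv[OF poly_DERIV] by simp
    qed
    show "deriv (\<lambda>u. poly (\<sigma> u) z) t / poly (\<sigma> t) z * (\<eta> t z - \<eta> t (lam t))
          - (deriv (\<lambda>u. \<eta> u z) t - deriv (\<lambda>u. \<eta> u (lam t)) t)
        = m * ((\<eta> t z - \<eta> t (lam t)) * 0 * poly (\<sigma> t) z / ((z - lam t) * (1 + 0 * (z - lam t)))
               - deriv (\<eta> t) (lam t) * 0 * poly (\<sigma> t) (lam t))
          + m / (z - lam t)\<^sup>2 *
            (2 * (poly (\<sigma> t) z * \<eta> t z) - 2 * (poly (\<sigma> t) (lam t) * \<eta> t (lam t))
             - (deriv (\<lambda>x. poly (\<sigma> t) x * \<eta> t x) z + deriv (\<lambda>x. poly (\<sigma> t) x * \<eta> t x) (lam t))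
               * (z - lam t))"
      unfolding eta_cond[OF sigma_lam z(1)] prod[OF z(1)] prod[OF sigma_lam]
        cubic_trapezoid[OF degs(2)] sd
      using z(2) by (simp add: power2_eq_square power3_eq_cube)
  qed
  have K: "((\<lambda>l. poly (\<tau> t) l - poly (pderiv (\<sigma> t)) l) has_field_derivative
      poly (pderiv (\<tau> t)) (lam t) - poly (pderiv (pderiv (\<sigma> t))) (lam t)) (at (lam t))"
    by (auto intro!: derivative_eq_intros)
  show ?thesis
    unfolding hamilton_equations_at[OF K]
    using hamilton_iff_compatible by simp
qed

theorem theorem4p2:
  fixes T :: "complex set"
    and \<sigma> \<tau> \<pi> \<rho> :: "complex \<Rightarrow> complex poly"
    and \<eta> :: "complex \<Rightarrow> complex \<Rightarrow> complex"
    and lam mu m s :: "complex \<Rightarrow> complex"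
  assumes "open T"
    and "heun_class T \<sigma> \<tau> \<eta> \<pi>"
    and "lam holomorphic_on T" and "mu holomorphic_on T"
    and "\<forall>t\<in>T. poly (\<sigma> t) (lam t) \<noteq> 0"
  shows
    "((\<forall>t\<in>T. poly (\<sigma> t) (s t) = 0 \<and> \<sigma> t = [:- s t, 1:] * \<rho> t) \<and>
      (\<forall>t\<in>T. \<forall>z. poly (\<sigma> t) z \<noteq> 0 \<longrightarrow>
         deriv (\<lambda>u. poly (\<tau> u) z / poly (\<sigma> u) z) t = m t * poly (\<tau> t) (s t) / (z - s t)\<^sup>2) \<and>
      (\<forall>t\<in>T. \<forall>l z. poly (\<sigma> t) l \<noteq> 0 \<and> poly (\<sigma> t) z \<noteq> 0 \<and> z \<noteq> l \<longrightarrow>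
         deriv (\<lambda>u. poly (\<sigma> u) z) t / poly (\<sigma> t) z * (\<eta> t z - \<eta> t l)
           - deriv (\<lambda>u. \<eta> u z) t + deriv (\<lambda>u. \<eta> u l) t
         = m t * ((\<eta> t z - \<eta> t l) * (l - s t) * poly (\<rho> t) z / ((z - l) * (z - s t))
                  - deriv (\<eta> t) l * poly (\<rho> t) l)
           + m t * (l - s t) / (z - l)\<^sup>2 *
             (2 * (poly (\<rho> t) z * \<eta> t z) - 2 * (poly (\<rho> t) l * \<eta> t l)
              - (deriv (\<lambda>x. poly (\<rho> t) x * \<eta> t x) z + deriv (\<lambda>x. poly (\<rho> t) x * \<eta> t x) l)
                * (z - l))) \<and>
      (\<forall>t\<in>T. \<forall>l z. poly (\<sigma> t) l \<noteq> 0 \<and> poly (\<sigma> t) z \<noteq> 0 \<longrightarrow>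
         deriv (\<lambda>u. poly (\<sigma> u) z) t / poly (\<sigma> t) z - deriv (\<lambda>u. poly (\<sigma> u) l) t / poly (\<sigma> t) l
         = m t * poly (\<rho> t) (s t) * ((z - l) / ((z - s t) * (l - s t))))
      \<longrightarrow>
      (hamilton_equations T
         (\<lambda>t l y. m t * (\<eta> t l + (poly (\<tau> t) l - (l - s t) * poly (pderiv (\<rho> t)) l) * y
                         + poly (\<sigma> t) l * y\<^sup>2))
         lam mu
       \<longleftrightarrow>
       deformed_compatibility T \<sigma> \<tau> \<eta> lam mu
         (\<lambda>t z. m t * (lam t - s t) * poly (\<rho> t) z / (z - lam t))
         (\<lambda>t z. - (m t * (lam t - s t) * poly (\<rho> t) (lam t) * mu t / (z - lam t)))))
     \<and>
     ((\<forall>t\<in>T. degree (\<sigma> t) \<le> 2 \<and> degree (\<pi> t) \<le> 3) \<and>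
      (\<forall>t\<in>T. \<forall>u\<in>T. \<sigma> t = \<sigma> u) \<and>
      (\<forall>t\<in>T. \<forall>z. poly (\<sigma> t) z \<noteq> 0 \<longrightarrow>
         deriv (\<lambda>u. poly (\<tau> u) z) t / poly (\<sigma> t) z
         = m t * (poly (pderiv (pderiv (\<tau> t))) z / 2)) \<and>
      (\<forall>t\<in>T. \<forall>l z. poly (\<sigma> t) l \<noteq> 0 \<and> poly (\<sigma> t) z \<noteq> 0 \<longrightarrow>
         deriv (\<lambda>u. \<eta> u z) t - deriv (\<lambda>u. \<eta> u l) t
         = m t * (poly (pderiv (pderiv (pderiv (\<pi> t)))) z / 6) * (z - l))
      \<longrightarrow>
      (hamilton_equations T
         (\<lambda>t l y. m t * (\<eta> t l + (poly (\<tau> t) l - poly (pderiv (\<sigma> t)) l) * y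
                         + poly (\<sigma> t) l * y\<^sup>2))
         lam mu
       \<longleftrightarrow>
       deformed_compatibility T \<sigma> \<tau> \<eta> lam mu
         (\<lambda>t z. m t * poly (\<sigma> t) z / (z - lam t))
         (\<lambda>t z. - (m t * poly (\<sigma> t) (lam t) * mu t / (z - lam t)))))"
proof -
  have dh: "deformed_heun T \<sigma> \<tau> \<pi> \<eta> lam mu t" if "t \<in> T" for t
    using assms that by unfold_locales auto
  \<comment> \<open>Both sides are conditions at each single \<open>t\<close>, and differentiate only in \<open>z\<close>, \<open>\<lambda>\<close>, \<open>\<mu>\<close>
     where they involve \<open>H\<close>, \<open>a\<close>, \<open>b\<close>; so \<open>H\<close>, \<open>a\<close> and \<open>b\<close> may be replaced by their values at that \<open>t\<close>.\<close>
  have pointwise: "hamilton_equations T H lam mu \<longleftrightarrow> deformed_compatibility T \<sigma> \<tau> \<eta> lam mu a b"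
    if "\<And>t. t \<in> T \<Longrightarrow> hamilton_equations {t} (\<lambda>_. H t) lam mu
          \<longleftrightarrow> deformed_compatibility {t} \<sigma> \<tau> \<eta> lam mu (\<lambda>_. a t) (\<lambda>_. b t)" for H a b
    using that unfolding hamilton_equations_def deformed_compatibility_def
      compatibility_conditions_def by simp
  show ?thesis
    by (intro conjI impI; rule pointwise;
        (rule finite_pole_case[OF dh] | rule pole_at_infinity_case[OF dh]); blast)
qed

end
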